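(* Let $\hat\xi^1,\dots,\hat\xi^N\in\mathbb R^s$, $\theta>0$, and let the data $X,c,q^l,T^l,W^l,h^l$ be as in the context. The semidefinite program $$\min\Big\{t\;:\;x\in X,\ t\in\mathbb R,\ y^l\in\mathbb R^m\ (l=0,\dots,s),\ \lambda_0\ge0,\ \lambda_{ij}\ge0\ (1\le i\le N,\,1\le j\le J),\ \text{(S1) and (S2) hold}\Big\}$$ is an exact reformulation of the affinely adjustable robust counterpart (AARC): that is, $z=(x,t,\{y^l\}_{l=0}^s)$ with $x\in X$ is feasible for (AARC) if and only if there exist $\lambda_0,\lambda_{ij}\ge0$ such that (S1) and (S2) hold. Here $$\text{(S1)}\quad\begin{pmatrix}\Gamma_0(z)\otimes I_N+\frac{\lambda_0}{N\theta^2}I_{sN}&\mathrm{vec}(\beta_0(z))\\ \mathrm{vec}(\beta_0(z))^\top&\alpha_0(z)-\lambda_0\end{pmatrix}\succeq0,$$ $$\text{(S2)}\quad\begin{pmatrix}\Gamma_j(z)+\frac{\lambda_{ij}}{N\theta^2}I_s&\beta_{ij}(z)\\ \beta_{ij}(z)^\top&\alpha_{ij}(z)-\lambda_{ij}\end{pmatrix}\succeq0\qquad\forall\,i=1,\dots,N,\ j=1,\dots,J.$$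
   Context: Two-stage data: $X$ is the first-stage feasible set in a Euclidean space, $c$ is a vector, and for $\xi\in\mathbb R^s$: $q(\xi)=q^0+\sum_{l=1}^s\xi_lq^l\in\mathbb R^m$, $T(\xi)=T^0+\sum_l\xi_lT^l$, $W(\xi)=W^0+\sum_l\xi_lW^l$ (matrices with $J$ rows), $h(\xi)=h^0+\sum_l\xi_lh^l\in\mathbb R^J$. Let $\mathfrak M_1=\{(\xi^1,\dots,\xi^N)\in(\mathbb R^s)^N:\frac1N\sum_i\|\xi^i-\hat\xi^i\|_2^2\le\theta^2\}$ and $B^i=\{\xi'\in\mathbb R^s:\|\xi'-\hat\xi^i\|_2\le\theta\sqrt N\}$. With affine decision rule $y(\xi)=y^0+\sum_{l=1}^s\xi_ly^l$, the problem (AARC) is: minimize $t$ over $x\in X$, $t\in\mathbb R$, $y^0,\dots,y^s\in\mathbb R^m$ subject to $c^\top x+\frac1N\sum_{i=1}^Nq(\xi^i)^\top y(\xi^i)-t\le0$ for all $(\xi^i)_{i=1}^N\in\mathfrak M_1$, and $T(\xi)x+W(\xi)y(\xi)-h(\xi)\le0$ (componentwise) for all $\xi\in\bigcup_{i=1}^NB^i$. (It is the affine-decision-rule restriction of $\min_{x\in X}\{c^\top x+\sup_{(\xi^i)\in\mathfrak M_1}\frac1N\sum_i\Psi(x,\xi^i)\}$ with $\Psi(x,\xi)=\min_y\{q(\xi)^\top y:T(\xi)x+W(\xi)y\le h(\xi)\}$.) Notation, with $z=(x,t,\{y^l\}_{l=0}^s)$, $T^l_j,W^l_j$ the $j$-th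 rows of $T^l,W^l$, and $i\le N$, $j\le J$, $1\le l,l'\le s$: $\alpha_0(z)=-[c^\top x+\frac1N\sum_iq(\hat\xi^i)^\top y(\hat\xi^i)-t]$; $\beta_0^{il}(z)=-\frac1{2N}[q(\hat\xi^i)^\top y^l+(q^l)^\top y(\hat\xi^i)]$, and $\beta_0(z)$ is the $N\times s$ matrix with these entries, $\mathrm{vec}$ stacking its columns; $\Gamma_0^{(l,l')}(z)=-\frac1{2N}[(q^l)^\top y^{l'}+(q^{l'})^\top y^l]$, and $\Gamma_0(z)$ is the $s\times s$ matrix with these entries; $\alpha_{ij}(z)=-[T_j(\hat\xi^i)x+W_j(\hat\xi^i)y(\hat\xi^i)-h_j(\hat\xi^i)]$, where subscript $j$ denotes the $j$-th row/component; $\beta_{ij}^l(z)=-\frac12[T_j^lx+W_j(\hat\xi^i)y^l+W_j^ly(\hat\xi^i)-h_j^l]$, $\beta_{ij}(z)=(\beta^l_{ij}(z))_l\in\mathbb R^s$; $\Gamma_j^{(l,l')}(z)=-\frac12[W^l_jy^{l'}+W^{l'}_jy^l]$, $\Gamma_j(z)=(\Gamma_j^{(l,l')}(z))_{l,l'}$. $\otimes$ is the Kronecker product, $I_n$ the $n\times n$ identity, $\succeq0$ means positive semidefinite. *)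

theory Defs
  imports "HOL-Analysis.Analysis"
begin

text \<open>
  Coefficients \<open>a\<^sup>0, a\<^sup>1, \<dots>, a\<^sup>s\<close> are families over \<^typ>\<open>'s option\<close>: \<^const>\<open>None\<close> stands for
  the index \<open>0\<close> and \<open>Some l\<close> for the index \<open>l\<close> in \<open>1, \<dots>, s\<close>.
\<close>

definition affine_fn :: "('s::finite option \<Rightarrow> 'v::real_vector) \<Rightarrow> real ^ 's \<Rightarrow> 'v" where
  "affine_fn a \<xi> = a None + (\<Sum>l\<in>UNIV. (\<xi> $ l) *\<^sub>R a (Some l))"

record ('n, 'm, 's, 'J) two_stage =
  stage1_set :: "(real ^ 'n) set"
  cost :: "real ^ 'n"
  qcoef :: "'s option \<Rightarrow> real ^ 'm"
  Tcoef :: "'s option \<Rightarrow> real ^ 'n ^ 'J"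
  Wcoef :: "'s option \<Rightarrow> real ^ 'm ^ 'J"
  hcoef :: "'s option \<Rightarrow> real ^ 'J"


subsection \<open>The affinely adjustable robust counterpart\<close>

definition wasserstein_set :: "real \<Rightarrow> ('N::finite \<Rightarrow> real ^ 's::finite) \<Rightarrow> ('N \<Rightarrow> real ^ 's) set" where
  "wasserstein_set \<theta> \<xi>hat =
     {\<xi>. (1 / real CARD('N)) * (\<Sum>i\<in>UNIV. (norm (\<xi> i - \<xi>hat i))\<^sup>2) \<le> \<theta>\<^sup>2}"

definition scenario_ball :: "real \<Rightarrow> ('N::finite \<Rightarrow> real ^ 's::finite) \<Rightarrow> 'N \<Rightarrow> (real ^ 's) set" where
  "scenario_ball \<theta> \<xi>hat i = {\<xi>. norm (\<xi> - \<xi>hat i) \<le> \<theta> * sqrt (real CARD('N))}"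

definition aarc_feasible ::
  "('n::finite, 'm::finite, 's::finite, 'J::finite) two_stage \<Rightarrow> real \<Rightarrow> ('N::finite \<Rightarrow> real ^ 's)
    \<Rightarrow> ((real ^ 'n) \<times> real \<times> ('s option \<Rightarrow> real ^ 'm)) set" where
  "aarc_feasible D \<theta> \<xi>hat = {(x, t, y). x \<in> stage1_set D \<and>
     (\<forall>\<xi> \<in> wasserstein_set \<theta> \<xi>hat.
        cost D \<bullet> x
        + (1 / real CARD('N)) * (\<Sum>i\<in>UNIV. affine_fn (qcoef D) (\<xi> i) \<bullet> affine_fn y (\<xi> i))
        - t \<le> 0) \<and>
     (\<forall>\<xi> \<in> (\<Union>i\<in>UNIV. scenario_ball \<theta> \<xi>hat i). \<forall>j.
        (affine_fn (Tcoef D) \<xi> *v x + affine_fn (Wcoef D) \<xi> *v affine_fn y \<xi>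
         - affine_fn (hcoef D) \<xi>) $ j \<le> 0)}"


subsection \<open>The semidefinite program\<close>

definition psd :: "real ^ 'k ^ 'k::finite \<Rightarrow> bool" where
  "psd A \<longleftrightarrow> transpose A = A \<and> (\<forall>v. 0 \<le> v \<bullet> (A *v v))"

definition kron :: "real ^ 'b::finite ^ 'a::finite \<Rightarrow> real ^ 'd::finite ^ 'c::finite
    \<Rightarrow> real ^ ('b \<times> 'd) ^ ('a \<times> 'c)" where
  "kron A B = (\<chi> p r. A $ fst p $ fst r * B $ snd p $ snd r)"

text \<open>
  Stacking the columns of \<open>A\<close>: the entry indexed by (column, row). This is the same index type,
  in the same order of factors, as that of \<open>kron G (mat 1)\<close> when \<open>G\<close> is indexed by the columns
  of \<open>A\<close> and \<open>mat 1\<close> by its rows.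
\<close>
definition vec_cols :: "real ^ 'b::finite ^ 'a::finite \<Rightarrow> real ^ ('b \<times> 'a)" where
  "vec_cols A = (\<chi> p. A $ snd p $ fst p)"

text \<open>The symmetric block matrix with blocks \<open>A\<close>, \<open>v\<close>, the transpose of \<open>v\<close>, and the scalar \<open>a\<close>.\<close>
definition bordered :: "real ^ 'k ^ 'k::finite \<Rightarrow> real ^ 'k \<Rightarrow> real \<Rightarrow> real ^ ('k + unit) ^ ('k + unit)"
  where
  "bordered A v a = (\<chi> p r. case p of
       Inl k \<Rightarrow> (case r of Inl k' \<Rightarrow> A $ k $ k' | Inr _ \<Rightarrow> v $ k)
     | Inr _ \<Rightarrow> (case r of Inl k' \<Rightarrow> v $ k' | Inr _ \<Rightarrow> a))"

definition alpha0 ::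
  "('n::finite, 'm::finite, 's::finite, 'J::finite) two_stage \<Rightarrow> ('N::finite \<Rightarrow> real ^ 's)
    \<Rightarrow> real ^ 'n \<Rightarrow> real \<Rightarrow> ('s option \<Rightarrow> real ^ 'm) \<Rightarrow> real" where
  "alpha0 D \<xi>hat x t y = - (cost D \<bullet> x
     + (1 / real CARD('N)) * (\<Sum>i\<in>UNIV. affine_fn (qcoef D) (\<xi>hat i) \<bullet> affine_fn y (\<xi>hat i)) - t)"

definition beta0 ::
  "('n::finite, 'm::finite, 's::finite, 'J::finite) two_stage \<Rightarrow> ('N::finite \<Rightarrow> real ^ 's)
    \<Rightarrow> ('s option \<Rightarrow> real ^ 'm) \<Rightarrow> real ^ 's ^ 'N" where
  "beta0 D \<xi>hat y = (\<chi> i l. - (1 / (2 * real CARD('N))) *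
     (affine_fn (qcoef D) (\<xi>hat i) \<bullet> y (Some l) + qcoef D (Some l) \<bullet> affine_fn y (\<xi>hat i)))"

text \<open>The argument \<open>\<xi>hat\<close> only serves to fix the index type \<^typ>\<open>'N\<close>, whose cardinality is \<open>N\<close>.\<close>
definition Gamma0 ::
  "('n::finite, 'm::finite, 's::finite, 'J::finite) two_stage \<Rightarrow> ('N::finite \<Rightarrow> real ^ 's)
    \<Rightarrow> ('s option \<Rightarrow> real ^ 'm) \<Rightarrow> real ^ 's ^ 's" where
  "Gamma0 D \<xi>hat y = (\<chi> l l'. - (1 / (2 * real CARD('N))) *
     (qcoef D (Some l) \<bullet> y (Some l') + qcoef D (Some l') \<bullet> y (Some l)))"

definition alphaS ::
  "('n::finite, 'm::finite, 's::finite, 'J::finite) two_stage \<Rightarrow> ('N::finite \<Rightarrow> real ^ 's)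
    \<Rightarrow> real ^ 'n \<Rightarrow> ('s option \<Rightarrow> real ^ 'm) \<Rightarrow> 'N \<Rightarrow> 'J \<Rightarrow> real" where
  "alphaS D \<xi>hat x y i j = - (affine_fn (Tcoef D) (\<xi>hat i) $ j \<bullet> x
     + affine_fn (Wcoef D) (\<xi>hat i) $ j \<bullet> affine_fn y (\<xi>hat i)
     - affine_fn (hcoef D) (\<xi>hat i) $ j)"

definition betaS ::
  "('n::finite, 'm::finite, 's::finite, 'J::finite) two_stage \<Rightarrow> ('N::finite \<Rightarrow> real ^ 's)
    \<Rightarrow> real ^ 'n \<Rightarrow> ('s option \<Rightarrow> real ^ 'm) \<Rightarrow> 'N \<Rightarrow> 'J \<Rightarrow> real ^ 's" where
  "betaS D \<xi>hat x y i j = (\<chi> l. - (1 / 2) *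
     (Tcoef D (Some l) $ j \<bullet> x
      + affine_fn (Wcoef D) (\<xi>hat i) $ j \<bullet> y (Some l)
      + Wcoef D (Some l) $ j \<bullet> affine_fn y (\<xi>hat i)
      - hcoef D (Some l) $ j))"

definition GammaS ::
  "('n::finite, 'm::finite, 's::finite, 'J::finite) two_stage
    \<Rightarrow> ('s option \<Rightarrow> real ^ 'm) \<Rightarrow> 'J \<Rightarrow> real ^ 's ^ 's" where
  "GammaS D y j = (\<chi> l l'. - (1 / 2) *
     (Wcoef D (Some l) $ j \<bullet> y (Some l') + Wcoef D (Some l') $ j \<bullet> y (Some l)))"

definition lmi_objective ::
  "('n::finite, 'm::finite, 's::finite, 'J::finite) two_stage \<Rightarrow> real \<Rightarrow> ('N::finite \<Rightarrow> real ^ 's)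
    \<Rightarrow> real ^ 'n \<Rightarrow> real \<Rightarrow> ('s option \<Rightarrow> real ^ 'm) \<Rightarrow> real \<Rightarrow> bool" where
  "lmi_objective D \<theta> \<xi>hat x t y lam0 \<longleftrightarrow>
     psd (bordered
       (kron (Gamma0 D \<xi>hat y) (mat 1 :: real ^ 'N ^ 'N)
         + (lam0 / (real CARD('N) * \<theta>\<^sup>2)) *\<^sub>R mat 1)
       (vec_cols (beta0 D \<xi>hat y))
       (alpha0 D \<xi>hat x t y - lam0))"

definition lmi_constraints ::
  "('n::finite, 'm::finite, 's::finite, 'J::finite) two_stage \<Rightarrow> real \<Rightarrow> ('N::finite \<Rightarrow> real ^ 's)
    \<Rightarrow> real ^ 'n \<Rightarrow> ('s option \<Rightarrow> real ^ 'm) \<Rightarrow> ('N \<Rightarrow> 'J \<Rightarrow> real) \<Rightarrow> bool" where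
  "lmi_constraints D \<theta> \<xi>hat x y lam \<longleftrightarrow> (\<forall>i j.
     psd (bordered
       (GammaS D y j + (lam i j / (real CARD('N) * \<theta>\<^sup>2)) *\<^sub>R mat 1)
       (betaS D \<xi>hat x y i j)
       (alphaS D \<xi>hat x y i j - lam i j)))"

definition sdp_feasible ::
  "('n::finite, 'm::finite, 's::finite, 'J::finite) two_stage \<Rightarrow> real \<Rightarrow> ('N::finite \<Rightarrow> real ^ 's)
    \<Rightarrow> ((real ^ 'n) \<times> real \<times> ('s option \<Rightarrow> real ^ 'm) \<times> real \<times> ('N \<Rightarrow> 'J \<Rightarrow> real)) set" where
  "sdp_feasible D \<theta> \<xi>hat = {(x, t, y, lam0, lam). x \<in> stage1_set D \<and> 0 \<le> lam0 \<and> (\<forall>i j. 0 \<le> lam i j) \<and>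
     lmi_objective D \<theta> \<xi>hat x t y lam0 \<and> lmi_constraints D \<theta> \<xi>hat x y lam}"

end

theory Submission imports Defs begin

text \<open>
  Both semi-infinite constraints of the robust counterpart ask that a quadratic function be
  nonnegative on a Euclidean ball of squared radius \<open>N \<theta>\<^sup>2\<close>. This is because coefficients and decision
  rule are affine in the uncertain parameter, so that their products are quadratic. For the
  objective constraint the ball consists of stacked vectors: a point of the ambiguity set is the nominal
  sample \<open>\<xi>hat\<close> displaced by \<open>N\<close> vectors, and stacking these displacements into one long vector turns
  the average squared distance into a squared norm. The quadratic is a sum over the samples with the
  same quadratic part \<open>\<Gamma>\<^sub>0\<close>, which gives the Kronecker product with the identity
  (\<open>objective_expansion\<close>). For the other constraints each pair \<open>(i, j)\<close> gives one quadratic on one ball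
  around \<open>\<xi>hat i\<close> (\<open>constraint_expansion\<close>), and the multipliers may be chosen pair by pair.

  A quadratic is nonnegative on a ball iff a linear matrix inequality holds for some multiplier
  (\<open>S_procedure_ball\<close>). Homogenizing with one extra variable \<open>s\<close> reduces this to the S-lemma for
  two quadratic forms, \<open>F\<close> from the given quadratic and \<open>G (v, s) = s\<^sup>2 - (norm v)\<^sup>2 / R\<close>: if \<open>F \<ge> 0\<close>
  wherever \<open>G \<ge> 0\<close>, then \<open>F - \<mu> G \<ge> 0\<close> everywhere for some \<open>\<mu> \<ge> 0\<close> (\<open>homogeneous_S_lemma\<close>).
  A suitable \<open>\<mu>\<close> has to lie above \<open>F w / G w\<close> where \<open>G w < 0\<close> and below \<open>F u / G u\<close> where
  \<open>G u > 0\<close>, so it exists once no ratio of the first kind exceeds one of the second kind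
  (\<open>quadratic_ratio_le\<close>). That comparison happens on the line through \<open>w\<close> in direction \<open>u\<close>: there \<open>G\<close>
  vanishes at two points on opposite sides of \<open>w\<close>, so \<open>F\<close> is nonnegative at both, and the convex
  combination of these two inequalities that cancels the linear term is the wanted inequality.

  The multipliers do not enter the objective \<open>t\<close>, and the feasible set of the counterpart is the
  projection of that of the semidefinite program. Hence optimal values and minimizers agree.
\<close>

section \<open>The S-lemma for two quadratic forms\<close>

text \<open>
  A quadratic form seen only through its restrictions to lines. The S-lemma needs no more than this,
  and so covers matrix forms and forms on product spaces alike.
\<close>
definition quadratic_along_lines :: "('v::real_vector \<Rightarrow> real) \<Rightarrow> bool" where
  "quadratic_along_lines Q \<longleftrightarrow>
     (\<forall>u w. \<exists>p. \<forall>\<tau>. Q (w + \<tau> *\<^sub>R u) = Q w + \<tau> * p + \<tau>\<^sup>2 * Q u)"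

lemma opposite_sign_roots:
  fixes a b c :: real
  assumes "a > 0" "c < 0"
  obtains \<tau> \<sigma> where "\<tau> < 0" "0 < \<sigma>" "\<tau> * \<sigma> = c / a"
    "c + \<tau> * b + \<tau>\<^sup>2 * a = 0" "c + \<sigma> * b + \<sigma>\<^sup>2 * a = 0"
proof -
  define d where "d = sqrt (b\<^sup>2 - 4 * a * c)"
  have ac: "a * c < 0" using assms by (simp add: mult_pos_neg)
  then have dd: "d\<^sup>2 = b\<^sup>2 - 4 * a * c" and "\<bar>b\<bar> < d"
    unfolding d_def by (auto simp: real_less_rsqrt intro!: order_trans[OF _ zero_le_power2[of b]])
  define \<tau> where "\<tau> = (- b - d) / (2 * a)"
  define \<sigma> where "\<sigma> = (- b + d) / (2 * a)"
  have signs: "\<tau> < 0" "0 < \<sigma>"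
    using \<open>\<bar>b\<bar> < d\<close> assms(1) by (auto simp: \<tau>_def \<sigma>_def divide_simps)
  have prod: "\<tau> * \<sigma> = c / a"
  proof -
    have "\<tau> * \<sigma> = (b\<^sup>2 - d\<^sup>2) / (4 * a\<^sup>2)"
      by (simp add: \<tau>_def \<sigma>_def power2_eq_square algebra_simps)
    then show ?thesis using dd assms(1) by (simp add: power2_eq_square)
  qed
  have root: "c + r * b + r\<^sup>2 * a = 0" if "(2 * a * r + b)\<^sup>2 = d\<^sup>2" for r
  proof -
    have "4 * a * (c + r * b + r\<^sup>2 * a) = (2 * a * r + b)\<^sup>2 - (b\<^sup>2 - 4 * a * c)"
      by (simp add: algebra_simps power2_eq_square)
    then show ?thesis using that dd assms(1) by simp
  qed
  have "c + \<tau> * b + \<tau>\<^sup>2 * a = 0" "c + \<sigma> * b + \<sigma>\<^sup>2 * a = 0"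
    by (rule root, use assms(1) in \<open>simp add: \<tau>_def \<sigma>_def\<close>)+
  then show thesis using that signs prod by blast
qed

text \<open>
  Let \<open>\<tau> < 0 < \<sigma>\<close> be the roots of \<open>G\<close> on the line \<open>w + r u\<close>. There \<open>F \<ge> 0\<close>, and weighting the two
  inequalities by \<open>\<sigma>\<close> and \<open>- \<tau>\<close> removes the unknown linear coefficient of \<open>F\<close>, leaving
  \<open>F w \<ge> \<tau> \<sigma> F u = (G w / G u) F u\<close>.
\<close>
lemma quadratic_ratio_le:
  assumes F: "quadratic_along_lines F" and G: "quadratic_along_lines G"
    and nonneg: "\<And>w. G w \<ge> 0 \<Longrightarrow> F w \<ge> 0"
    and "G u > 0" "G w < 0"
  shows "F w / G w \<le> F u / G u"
proof -
  obtain p where p: "\<And>\<tau>. F (w + \<tau> *\<^sub>R u) = F w + \<tau> * p + \<tau>\<^sup>2 * F u"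
    using F unfolding quadratic_along_lines_def by meson
  obtain g where g: "\<And>\<tau>. G (w + \<tau> *\<^sub>R u) = G w + \<tau> * g + \<tau>\<^sup>2 * G u"
    using G unfolding quadratic_along_lines_def by meson
  obtain \<tau> \<sigma> where signs: "\<tau> < 0" "0 < \<sigma>" and prod: "\<tau> * \<sigma> = G w / G u"
    and roots: "G w + \<tau> * g + \<tau>\<^sup>2 * G u = 0" "G w + \<sigma> * g + \<sigma>\<^sup>2 * G u = 0"
    using opposite_sign_roots[OF assms(4,5)] by metis
  have "0 \<le> F w + \<tau> * p + \<tau>\<^sup>2 * F u" "0 \<le> F w + \<sigma> * p + \<sigma>\<^sup>2 * F u"
    using nonneg g p roots by (metis order_refl)+
  then have "0 \<le> \<sigma> * (F w + \<tau> * p + \<tau>\<^sup>2 * F u)" "0 \<le> (- \<tau>) * (F w + \<sigma> * p + \<sigma>\<^sup>2 * F u)"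
    using signs by (auto intro: mult_nonneg_nonneg mult_nonpos_nonneg)
  then have "0 \<le> \<sigma> * (F w + \<tau> * p + \<tau>\<^sup>2 * F u) + (- \<tau>) * (F w + \<sigma> * p + \<sigma>\<^sup>2 * F u)"
    by (rule add_nonneg_nonneg)
  also have "\<dots> = (\<sigma> - \<tau>) * (F w - \<tau> * \<sigma> * F u)"
    by (simp add: algebra_simps power2_eq_square)
  finally have "0 \<le> F w - \<tau> * \<sigma> * F u"
    using signs by (simp add: zero_le_mult_iff)
  then have "F u * G w / G u \<le> F w"
    by (simp add: prod mult.commute[of "F u"])
  then show ?thesis
    using assms(4,5) by (simp add: field_simps)
qed

text \<open>
  The largest admissible multiplier is \<open>\<mu> = Inf (F u / G u)\<close> over all \<open>u\<close> with \<open>G u > 0\<close>. The Slater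
  point \<open>u0\<close> makes this infimum one over a nonempty set; \<open>quadratic_ratio_le\<close> shows that it is large
  enough for the points with \<open>G w < 0\<close>.
\<close>
theorem homogeneous_S_lemma:
  assumes F: "quadratic_along_lines F" and G: "quadratic_along_lines G"
    and slater: "G u0 > 0"
    and nonneg: "\<And>w. G w \<ge> 0 \<Longrightarrow> F w \<ge> 0"
  shows "\<exists>\<mu>\<ge>0. \<forall>w. 0 \<le> F w - \<mu> * G w"
proof -
  define R where "R = (\<lambda>u. F u / G u) ` {u. G u > 0}"
  define \<mu> where "\<mu> = Inf R"
  have ne: "R \<noteq> {}" using slater by (auto simp: R_def)
  have R0: "0 \<le> r" if "r \<in> R" for r
    using that nonneg by (auto simp: R_def intro!: divide_nonneg_nonneg)
  have bdd: "bdd_below R" using R0 by (meson bdd_below.I)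
  have "0 \<le> \<mu>" unfolding \<mu>_def using ne R0 by (rule cInf_greatest)
  moreover have "0 \<le> F w - \<mu> * G w" for w
  proof (cases "G w" "0 :: real" rule: linorder_cases)
    case less
    have "F w / G w \<le> \<mu>"
      unfolding \<mu>_def using ne
      by (rule cInf_greatest) (auto simp: R_def intro: quadratic_ratio_le[OF F G nonneg _ less])
    then show ?thesis using less by (simp add: field_simps)
  next
    case equal
    then show ?thesis using nonneg by simp
  next
    case greater
    then have "\<mu> \<le> F w / G w"
      unfolding \<mu>_def using bdd by (intro cInf_lower) (auto simp: R_def)
    then show ?thesis using greater by (simp add: field_simps)
  qed
  ultimately show ?thesis by blast
qed

section \<open>Nonnegativity of a quadratic on a ball as a matrix inequality\<close>

lemma quadratic_form_bordered:
  fixes A :: "real ^ 'k ^ 'k::finite"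
  shows "w \<bullet> (bordered A b a *v w) =
    (\<chi> k. w $ Inl k) \<bullet> (A *v (\<chi> k. w $ Inl k)) + 2 * w $ Inr () * (b \<bullet> (\<chi> k. w $ Inl k))
      + a * (w $ Inr ())\<^sup>2"
proof -
  have split: "(\<Sum>p\<in>UNIV. f p) = (\<Sum>k\<in>UNIV. f (Inl k)) + f (Inr ())"
    for f :: "'k + unit \<Rightarrow> real"
    by (simp add: UNIV_sum sum.union_disjoint sum.reindex image_iff disjoint_iff UNIV_unit)
  show ?thesis
    by (simp add: inner_vec_def matrix_vector_mult_def bordered_def split algebra_simps
        sum.distrib sum_distrib_left sum_distrib_right power2_eq_square)
qed

lemma psd_bordered_iff:
  fixes A :: "real ^ 'k ^ 'k::finite"
  assumes "transpose A = A"
  shows "psd (bordered A b a) \<longleftrightarrow>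
    (\<forall>v s. 0 \<le> v \<bullet> (A *v v) + 2 * s * (b \<bullet> v) + a * s\<^sup>2)"
proof -
  have "A $ k $ k' = A $ k' $ k" for k k'
    using assms by (metis transpose_def vec_lambda_beta)
  then have sym: "transpose (bordered A b a) = bordered A b a"
    by (auto simp: transpose_def bordered_def vec_eq_iff split: sum.splits)
  have "0 \<le> v \<bullet> (A *v v) + 2 * s * (b \<bullet> v) + a * s\<^sup>2"
    if "\<And>w. 0 \<le> w \<bullet> (bordered A b a *v w)" for v s
    using that[of "\<chi> p. case p of Inl k \<Rightarrow> v $ k | Inr _ \<Rightarrow> s"]
    by (simp add: quadratic_form_bordered)
  then show ?thesis
    using sym unfolding psd_def by (auto simp: quadratic_form_bordered)
qed

lemma quadratic_along_lines_bordered_form: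
  fixes A :: "real ^ 'k ^ 'k::finite"
  shows "quadratic_along_lines (\<lambda>(v, s). v \<bullet> (A *v v) + 2 * s * (b \<bullet> v) + a * s\<^sup>2)"
  unfolding quadratic_along_lines_def
proof (intro allI)
  fix u w :: "(real ^ 'k) \<times> real"
  obtain u1 u2 w1 w2 where [simp]: "u = (u1, u2)" "w = (w1, w2)" by force
  show "\<exists>p. \<forall>\<tau>. (case w + \<tau> *\<^sub>R u of (v, s) \<Rightarrow> v \<bullet> (A *v v) + 2 * s * (b \<bullet> v) + a * s\<^sup>2) =
      (case w of (v, s) \<Rightarrow> v \<bullet> (A *v v) + 2 * s * (b \<bullet> v) + a * s\<^sup>2) + \<tau> * p
      + \<tau>\<^sup>2 * (case u of (v, s) \<Rightarrow> v \<bullet> (A *v v) + 2 * s * (b \<bullet> v) + a * s\<^sup>2)"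
    \<comment> \<open>The witness is the polarization of the form, twice its bilinear form at \<open>u\<close> and \<open>w\<close>.\<close>
    by (rule exI[of _ "w1 \<bullet> (A *v u1) + u1 \<bullet> (A *v w1) + 2 * u2 * (b \<bullet> w1) + 2 * w2 * (b \<bullet> u1)
           + 2 * a * u2 * w2"])
      (simp add: matrix_vector_right_distrib matrix_vector_mult_scaleR inner_add_left
        inner_add_right power2_eq_square algebra_simps)
qed

lemma scaled_identity_mult: "(c *\<^sub>R mat 1) *v v = c *\<^sub>R (v :: real ^ 'k::finite)"
  by (metis scaleR_matrix_vector_assoc matrix_vector_mul_lid)

text \<open>
  For the hard direction, nonnegativity on the ball has to be passed to the homogenized form on the
  cone \<open>(norm v)\<^sup>2 \<le> R s\<^sup>2\<close>. If \<open>s \<noteq> 0\<close>, the point \<open>v / s\<close> lies in the ball; if \<open>s = 0\<close>, boundedness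
  of the ball forces \<open>v = 0\<close>. The centre of the ball, \<open>(0, 1)\<close>, is the Slater point.
\<close>
theorem S_procedure_ball:
  fixes A :: "real ^ 'k ^ 'k::finite"
  assumes sym: "transpose A = A" and "R > 0"
  shows "(\<forall>v. (norm v)\<^sup>2 \<le> R \<longrightarrow> 0 \<le> v \<bullet> (A *v v) + 2 * (b \<bullet> v) + a) \<longleftrightarrow>
    (\<exists>\<mu>\<ge>0. psd (bordered (A + (\<mu> / R) *\<^sub>R mat 1) b (a - \<mu>)))"
    (is "?ball \<longleftrightarrow> ?lmi")
proof -
  define F where "F = (\<lambda>(v, s). v \<bullet> (A *v v) + 2 * s * (b \<bullet> v) + a * s\<^sup>2)"
  \<comment> \<open>\<open>G\<close> is written in the shape of \<open>F\<close>, so that one lemma shows both to be quadratic along lines.\<close>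
  define G :: "(real ^ 'k) \<times> real \<Rightarrow> real" where
    "G = (\<lambda>(v, s). v \<bullet> (((- 1 / R) *\<^sub>R mat 1) *v v) + 2 * s * (0 \<bullet> v) + 1 * s\<^sup>2)"
  have G_eq: "G (v, s) = s\<^sup>2 - (norm v)\<^sup>2 / R" for v s
    unfolding G_def prod.case scaled_identity_mult by (simp add: power2_norm_eq_inner)
  have psd_eq: "psd (bordered (A + (\<mu> / R) *\<^sub>R mat 1) b (a - \<mu>)) \<longleftrightarrow>
      (\<forall>w. 0 \<le> F w - \<mu> * G w)" for \<mu>
  proof -
    have "transpose (A + (\<mu> / R) *\<^sub>R mat 1) = A + (\<mu> / R) *\<^sub>R mat 1"
      using sym by (simp add: transpose_def vec_eq_iff mat_def)
    moreover have "v \<bullet> ((A + (\<mu> / R) *\<^sub>R mat 1) *v v) + 2 * s * (b \<bullet> v) + (a - \<mu>) * s\<^sup>2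
        = F (v, s) - \<mu> * G (v, s)" for v s
      by (simp add: F_def G_eq matrix_vector_mult_add_rdistrib scaled_identity_mult
          inner_add_right power2_norm_eq_inner algebra_simps)
    ultimately show ?thesis by (simp add: psd_bordered_iff)
  qed
  show ?thesis
  proof
    assume ball: ?ball
    have "F w \<ge> 0" if "G w \<ge> 0" for w
    proof -
      obtain v s where w: "w = (v, s)" by force
      have le: "(norm v)\<^sup>2 \<le> R * s\<^sup>2"
        using that \<open>R > 0\<close> by (simp add: w G_eq field_simps)
      show ?thesis
      proof (cases "s = 0")
        case True
        then show ?thesis using le by (simp add: w F_def)
      next
        case False
        have "(norm ((1 / s) *\<^sub>R v))\<^sup>2 \<le> R"
          using le False by (simp add: power_divide field_simps)
        then have "0 \<le> ((1 / s) *\<^sub>R v) \<bullet> (A *v ((1 / s) *\<^sub>R v)) + 2 * (b \<bullet> ((1 / s) *\<^sub>R v)) + a"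
          using ball by blast
        then have "0 \<le> s\<^sup>2 * (((1 / s) *\<^sub>R v) \<bullet> (A *v ((1 / s) *\<^sub>R v)) + 2 * (b \<bullet> ((1 / s) *\<^sub>R v)) + a)"
          by simp
        also have "\<dots> = F w"
          using False by (simp add: w F_def matrix_vector_mult_scaleR power2_eq_square field_simps)
        finally show ?thesis .
      qed
    qed
    moreover have "G (0, 1) > 0" by (simp add: G_eq)
    moreover have "quadratic_along_lines F" "quadratic_along_lines G"
      unfolding F_def G_def by (rule quadratic_along_lines_bordered_form)+
    ultimately show ?lmi
      using homogeneous_S_lemma[of F G "(0, 1)"] by (simp add: psd_eq)
  next
    assume ?lmi
    then obtain \<mu> where "\<mu> \<ge> 0" and FG: "\<And>w. 0 \<le> F w - \<mu> * G w"
      by (auto simp: psd_eq)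
    show ?ball
    proof (intro allI impI)
      fix v :: "real ^ 'k"
      assume "(norm v)\<^sup>2 \<le> R"
      then have "0 \<le> \<mu> * G (v, 1)"
        using \<open>R > 0\<close> \<open>\<mu> \<ge> 0\<close> by (simp add: G_eq)
      then show "0 \<le> v \<bullet> (A *v v) + 2 * (b \<bullet> v) + a"
        using FG[of "(v, 1)"] by (simp add: F_def)
    qed
  qed
qed

section \<open>Second-order expansion around a nominal point\<close>

lemma affine_fn_add:
  "affine_fn a (\<xi> + v) = affine_fn a \<xi> + (\<Sum>l\<in>UNIV. v $ l *\<^sub>R a (Some l))"
  by (simp add: affine_fn_def scaleR_add_left sum.distrib)

lemma affine_fn_nth: "affine_fn a \<xi> $ j = affine_fn (\<lambda>p. a p $ j) \<xi>"
  by (simp add: affine_fn_def)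

lemma inner_affine_fn_add:
  fixes p y :: "'s::finite option \<Rightarrow> 'v::real_inner"
  shows "affine_fn p (\<xi> + v) \<bullet> affine_fn y (\<xi> + v) =
    affine_fn p \<xi> \<bullet> affine_fn y \<xi>
    + (\<Sum>l\<in>UNIV. (affine_fn p \<xi> \<bullet> y (Some l) + p (Some l) \<bullet> affine_fn y \<xi>) * v $ l)
    + (\<Sum>l\<in>UNIV. \<Sum>l'\<in>UNIV. v $ l * v $ l' * (p (Some l) \<bullet> y (Some l')))"
  unfolding affine_fn_add inner_add_left inner_add_right inner_sum_left inner_sum_right
  by (simp add: sum.distrib algebra_simps inner_sum_right sum_distrib_left)
    (subst sum.swap, simp add: mult.left_commute)

text \<open>
  The matrices of the program are symmetrized so that they can be positive semidefinite. The
  quadratic form only sees the symmetric part, so nothing is lost.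
\<close>
lemma quadratic_form_symmetrization:
  fixes p y :: "'s::finite \<Rightarrow> 'v::real_inner"
  shows "v \<bullet> ((\<chi> l l'. c * (p l \<bullet> y l' + p l' \<bullet> y l)) *v v) =
    2 * c * (\<Sum>l\<in>UNIV. \<Sum>l'\<in>UNIV. v $ l * v $ l' * (p l \<bullet> y l'))"
proof -
  have "v \<bullet> ((\<chi> l l'. c * (p l \<bullet> y l' + p l' \<bullet> y l)) *v v) =
     c * (\<Sum>l\<in>UNIV. \<Sum>l'\<in>UNIV. v $ l * v $ l' * (p l \<bullet> y l'))
     + c * (\<Sum>l\<in>UNIV. \<Sum>l'\<in>UNIV. v $ l' * v $ l * (p l' \<bullet> y l))"
    by (simp add: inner_vec_def matrix_vector_mult_def sum_distrib_left sum.distrib algebra_simps)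
  also have "(\<Sum>l\<in>UNIV. \<Sum>l'\<in>UNIV. v $ l' * v $ l * (p l' \<bullet> y l)) =
     (\<Sum>l\<in>UNIV. \<Sum>l'\<in>UNIV. v $ l * v $ l' * (p l \<bullet> y l'))"
    by (rule sum.swap)
  finally show ?thesis by simp
qed

section \<open>Stacked displacements\<close>

text \<open>
  A family of \<open>N\<close> displacements is one vector with the index type (coordinate, sample), the order of
  factors used by \<^const>\<open>vec_cols\<close> and by \<^const>\<open>kron\<close> in the objective inequality.
\<close>
definition stack_block :: "real ^ ('s::finite \<times> 'N::finite) \<Rightarrow> 'N \<Rightarrow> real ^ 's" where
  "stack_block v i = (\<chi> l. v $ (l, i))"

lemma sum_UNIV_prod:
  fixes f :: "'a::finite \<times> 'b::finite \<Rightarrow> real"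
  shows "(\<Sum>k\<in>UNIV. f k) = (\<Sum>i\<in>UNIV. \<Sum>l\<in>UNIV. f (l, i))"
proof -
  have "(\<Sum>k\<in>UNIV. f k) = (\<Sum>l\<in>UNIV. \<Sum>i\<in>UNIV. f (l, i))"
    by (simp add: sum.cartesian_product UNIV_Times_UNIV)
  then show ?thesis by (subst (asm) sum.swap)
qed

lemma norm_stack: "(norm v)\<^sup>2 = (\<Sum>i\<in>UNIV. (norm (stack_block v i))\<^sup>2)"
  by (simp add: power2_norm_eq_inner inner_vec_def sum_UNIV_prod stack_block_def)

lemma vec_cols_inner: "vec_cols B \<bullet> v = (\<Sum>i\<in>UNIV. B $ i \<bullet> stack_block v i)"
  by (simp add: inner_vec_def sum_UNIV_prod stack_block_def vec_cols_def)

lemma quadratic_form_kron_mat_1: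
  fixes G :: "real ^ 's::finite ^ 's" and v :: "real ^ ('s \<times> 'N::finite)"
  shows "v \<bullet> (kron G (mat 1) *v v) = (\<Sum>i\<in>UNIV. stack_block v i \<bullet> (G *v stack_block v i))"
proof -
  have "(kron G (mat 1) *v v) $ (l, i) = (G *v stack_block v i) $ l" for l i
    by (simp add: matrix_vector_mult_def sum_UNIV_prod kron_def mat_def stack_block_def
        if_distrib if_distribR cong: if_cong) (subst sum.swap, simp)
  then show ?thesis
    by (simp add: inner_vec_def sum_UNIV_prod stack_block_def)
qed

section \<open>The uncertainty sets as balls around the nominal data\<close>

lemma wasserstein_set_iff:
  fixes \<xi>hat :: "'N::finite \<Rightarrow> real ^ 's::finite"
  shows "(\<forall>\<xi>\<in>wasserstein_set \<theta> \<xi>hat. P \<xi>) \<longleftrightarrow>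
    (\<forall>v. (norm v)\<^sup>2 \<le> real CARD('N) * \<theta>\<^sup>2 \<longrightarrow> P (\<lambda>i. \<xi>hat i + stack_block v i))"
proof -
  have mem: "\<xi> \<in> wasserstein_set \<theta> \<xi>hat \<longleftrightarrow>
      (\<Sum>i\<in>UNIV. (norm (\<xi> i - \<xi>hat i))\<^sup>2) \<le> real CARD('N) * \<theta>\<^sup>2" for \<xi>
    by (simp add: wasserstein_set_def field_simps)
  have "P \<xi>" if "\<xi> \<in> wasserstein_set \<theta> \<xi>hat"
    and v: "\<And>v. (norm v)\<^sup>2 \<le> real CARD('N) * \<theta>\<^sup>2 \<Longrightarrow> P (\<lambda>i. \<xi>hat i + stack_block v i)" for \<xi>
  proof -
    define v :: "real ^ ('s \<times> 'N)" where "v = (\<chi> k. (\<xi> (snd k) - \<xi>hat (snd k)) $ fst k)"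
    have "stack_block v i = \<xi> i - \<xi>hat i" for i
      by (simp add: stack_block_def v_def vec_eq_iff)
    then show ?thesis
      using that(1) v[of v] by (simp add: mem norm_stack)
  qed
  then show ?thesis by (auto simp: mem norm_stack)
qed

lemma scenario_ball_iff:
  fixes \<xi>hat :: "'N::finite \<Rightarrow> real ^ 's::finite"
  assumes "\<theta> > 0"
  shows "(\<forall>\<xi>\<in>scenario_ball \<theta> \<xi>hat i. P \<xi>) \<longleftrightarrow>
    (\<forall>v. (norm v)\<^sup>2 \<le> real CARD('N) * \<theta>\<^sup>2 \<longrightarrow> P (\<xi>hat i + v))"
proof -
  have "real CARD('N) * \<theta>\<^sup>2 = (\<theta> * sqrt (real CARD('N)))\<^sup>2"
    by (simp add: power_mult_distrib)
  then have le: "(norm v)\<^sup>2 \<le> real CARD('N) * \<theta>\<^sup>2 \<longleftrightarrow> norm v \<le> \<theta> * sqrt (real CARD('N))"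
    for v :: "real ^ 's"
    using assms by (metis abs_le_square_iff abs_norm_cancel abs_of_nonneg less_imp_le
        mult_nonneg_nonneg of_nat_0_le_iff real_sqrt_ge_zero)
  show ?thesis
    unfolding le by (auto simp: scenario_ball_def)
qed

section \<open>The robust constraints as matrix inequalities\<close>

text \<open>
  The normalizations of \<^const>\<open>Gamma0\<close> and \<^const>\<open>beta0\<close> are read off here: the factor \<open>1 / 2\<close> undoes
  the doubling by symmetrization in the former and by the convention \<open>2 (b \<bullet> v)\<close> in the latter, and
  the sign turns the constraint \<open>\<le> 0\<close> into nonnegativity of a quadratic.
\<close>
lemma objective_expansion:
  fixes \<xi>hat :: "'N::finite \<Rightarrow> real ^ 's::finite"
  shows "- (cost D \<bullet> x + (1 / real CARD('N)) * (\<Sum>i\<in>UNIV.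
        affine_fn (qcoef D) (\<xi>hat i + stack_block v i) \<bullet> affine_fn y (\<xi>hat i + stack_block v i)) - t)
    = v \<bullet> (kron (Gamma0 D \<xi>hat y) (mat 1) *v v) + 2 * (vec_cols (beta0 D \<xi>hat y) \<bullet> v)
      + alpha0 D \<xi>hat x t y"
proof -
  let ?Q = "\<lambda>i. \<Sum>l\<in>UNIV. \<Sum>l'\<in>UNIV.
    stack_block v i $ l * stack_block v i $ l' * (qcoef D (Some l) \<bullet> y (Some l'))"
  let ?L = "\<lambda>i. \<Sum>l\<in>UNIV. (affine_fn (qcoef D) (\<xi>hat i) \<bullet> y (Some l)
    + qcoef D (Some l) \<bullet> affine_fn y (\<xi>hat i)) * stack_block v i $ l"
  have "v \<bullet> (kron (Gamma0 D \<xi>hat y) (mat 1) *v v) = - (1 / real CARD('N)) * (\<Sum>i\<in>UNIV. ?Q i)"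
    unfolding quadratic_form_kron_mat_1 Gamma0_def
      quadratic_form_symmetrization[where p = "\<lambda>l. qcoef D (Some l)" and y = "\<lambda>l. y (Some l)"]
    by (simp add: sum_distrib_left)
  moreover have "beta0 D \<xi>hat y $ i \<bullet> stack_block v i = - (1 / (2 * real CARD('N))) * ?L i" for i
    by (simp add: beta0_def inner_vec_def sum_distrib_left mult.assoc sum_negf)
  then have "2 * (vec_cols (beta0 D \<xi>hat y) \<bullet> v) = - (1 / real CARD('N)) * (\<Sum>i\<in>UNIV. ?L i)"
    by (simp add: vec_cols_inner sum_distrib_left[symmetric] sum_negf sum_divide_distrib[symmetric])
  ultimately show ?thesis
    by (simp add: inner_affine_fn_add alpha0_def sum.distrib algebra_simps add_divide_distrib)
qed

lemma constraint_expansion: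
  "- ((affine_fn (Tcoef D) (\<xi>hat i + v) *v x + affine_fn (Wcoef D) (\<xi>hat i + v) *v affine_fn y (\<xi>hat i + v)
        - affine_fn (hcoef D) (\<xi>hat i + v)) $ j)
    = v \<bullet> (GammaS D y j *v v) + 2 * (betaS D \<xi>hat x y i j \<bullet> v) + alphaS D \<xi>hat x y i j"
proof -
  let ?W = "\<lambda>p. Wcoef D p $ j"
  have row: "(A *v z) $ j = A $ j \<bullet> z" for A :: "real ^ 'q::finite ^ 'r::finite" and j z
    by (simp add: matrix_vector_mult_def inner_vec_def)
  have "v \<bullet> (GammaS D y j *v v) =
      - (\<Sum>l\<in>UNIV. \<Sum>l'\<in>UNIV. v $ l * v $ l' * (?W (Some l) \<bullet> y (Some l')))"
    unfolding GammaS_def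
      quadratic_form_symmetrization[where p = "\<lambda>l. ?W (Some l)" and y = "\<lambda>l. y (Some l)"]
    by simp
  moreover have "2 * (betaS D \<xi>hat x y i j \<bullet> v) =
      - (\<Sum>l\<in>UNIV. (affine_fn ?W (\<xi>hat i) \<bullet> y (Some l) + ?W (Some l) \<bullet> affine_fn y (\<xi>hat i)) * v $ l)
      - (\<Sum>l\<in>UNIV. v $ l *\<^sub>R (Tcoef D (Some l) $ j)) \<bullet> x
      + (\<Sum>l\<in>UNIV. v $ l *\<^sub>R (hcoef D (Some l) $ j))"
    by (simp add: betaS_def inner_vec_def[of _ v] affine_fn_nth inner_sum_left sum_distrib_left
        sum_negf[symmetric] sum_subtractf[symmetric] sum.distrib[symmetric] algebra_simps)
  ultimately show ?thesis
    by (simp add: row affine_fn_nth inner_affine_fn_add alphaS_def)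
      (simp add: affine_fn_add inner_add_left)
qed

lemma transpose_kron: "transpose (kron A B) = kron (transpose A) (transpose B)"
  by (simp add: transpose_def kron_def vec_eq_iff)

lemma objective_robust_iff:
  fixes D :: "('n::finite, 'm::finite, 's::finite, 'J::finite) two_stage"
    and \<xi>hat :: "'N::finite \<Rightarrow> real ^ 's"
  assumes "\<theta> > 0"
  shows "(\<forall>\<xi>\<in>wasserstein_set \<theta> \<xi>hat. cost D \<bullet> x
        + (1 / real CARD('N)) * (\<Sum>i\<in>UNIV. affine_fn (qcoef D) (\<xi> i) \<bullet> affine_fn y (\<xi> i)) - t \<le> 0)
    \<longleftrightarrow> (\<exists>lam0\<ge>0. lmi_objective D \<theta> \<xi>hat x t y lam0)"
proof -
  have "transpose (Gamma0 D \<xi>hat y) = Gamma0 D \<xi>hat y"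
    by (simp add: transpose_def Gamma0_def vec_eq_iff add.commute)
  then have sym: "transpose (kron (Gamma0 D \<xi>hat y) (mat 1 :: real ^ 'N ^ 'N))
      = kron (Gamma0 D \<xi>hat y) (mat 1)"
    by (simp add: transpose_kron)
  have pos: "0 < real CARD('N) * \<theta>\<^sup>2" using assms by simp
  have neg: "r \<le> 0 \<longleftrightarrow> 0 \<le> - r" for r :: real by simp
  show ?thesis
    unfolding lmi_objective_def S_procedure_ball[OF sym pos, symmetric]
      wasserstein_set_iff objective_expansion[symmetric] neg ..
qed

lemma constraint_robust_iff:
  fixes D :: "('n::finite, 'm::finite, 's::finite, 'J::finite) two_stage"
    and \<xi>hat :: "'N::finite \<Rightarrow> real ^ 's"
  assumes "\<theta> > 0"
  shows "(\<forall>\<xi>\<in>(\<Union>i\<in>UNIV. scenario_ball \<theta> \<xi>hat i). \<forall>j.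
        (affine_fn (Tcoef D) \<xi> *v x + affine_fn (Wcoef D) \<xi> *v affine_fn y \<xi>
         - affine_fn (hcoef D) \<xi>) $ j \<le> 0)
    \<longleftrightarrow> (\<exists>lam. (\<forall>i j. 0 \<le> lam i j) \<and> lmi_constraints D \<theta> \<xi>hat x y lam)"
proof -
  have sym: "transpose (GammaS D y j) = GammaS D y j" for j
    by (simp add: transpose_def GammaS_def vec_eq_iff add.commute)
  have pos: "0 < real CARD('N) * \<theta>\<^sup>2" using assms by simp
  have neg: "r \<le> 0 \<longleftrightarrow> 0 \<le> - r" for r :: real by simp
  have "(\<forall>\<xi>\<in>(\<Union>i\<in>UNIV. scenario_ball \<theta> \<xi>hat i). \<forall>j.
        (affine_fn (Tcoef D) \<xi> *v x + affine_fn (Wcoef D) \<xi> *v affine_fn y \<xi>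
         - affine_fn (hcoef D) \<xi>) $ j \<le> 0) \<longleftrightarrow>
      (\<forall>i j. \<forall>\<xi>\<in>scenario_ball \<theta> \<xi>hat i.
        (affine_fn (Tcoef D) \<xi> *v x + affine_fn (Wcoef D) \<xi> *v affine_fn y \<xi>
         - affine_fn (hcoef D) \<xi>) $ j \<le> 0)"
    by blast
  also have "\<dots> \<longleftrightarrow> (\<forall>i j. \<exists>\<mu>\<ge>0. psd (bordered
       (GammaS D y j + (\<mu> / (real CARD('N) * \<theta>\<^sup>2)) *\<^sub>R mat 1)
       (betaS D \<xi>hat x y i j) (alphaS D \<xi>hat x y i j - \<mu>)))"
    unfolding S_procedure_ball[OF sym pos, symmetric] scenario_ball_iff[OF assms]
      constraint_expansion[symmetric] neg ..
  \<comment> \<open>Each pair has its own ball constraint, so multipliers found pair by pair form one family.\<close>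
  also have "\<dots> \<longleftrightarrow> (\<exists>lam. (\<forall>i j. 0 \<le> lam i j) \<and> lmi_constraints D \<theta> \<xi>hat x y lam)"
    unfolding lmi_constraints_def choice_iff by (simp add: all_conj_distrib)
  finally show ?thesis .
qed

lemma aarc_feasible_iff_lmi:
  assumes "\<theta> > 0"
  shows "(x, t, y) \<in> aarc_feasible D \<theta> \<xi>hat \<longleftrightarrow> x \<in> stage1_set D \<and>
     (\<exists>lam0 lam. 0 \<le> lam0 \<and> (\<forall>i j. 0 \<le> lam i j) \<and>
        lmi_objective D \<theta> \<xi>hat x t y lam0 \<and> lmi_constraints D \<theta> \<xi>hat x y lam)"
proof -
  have "(x, t, y) \<in> aarc_feasible D \<theta> \<xi>hat \<longleftrightarrow> x \<in> stage1_set D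
      \<and> (\<exists>lam0\<ge>0. lmi_objective D \<theta> \<xi>hat x t y lam0)
      \<and> (\<exists>lam. (\<forall>i j. 0 \<le> lam i j) \<and> lmi_constraints D \<theta> \<xi>hat x y lam)"
    unfolding aarc_feasible_def objective_robust_iff[OF assms, symmetric]
      constraint_robust_iff[OF assms, symmetric] by simp
  then show ?thesis by blast
qed

lemma aarc_feasible_iff_sdp:
  assumes "\<theta> > 0"
  shows "(x, t, y) \<in> aarc_feasible D \<theta> \<xi>hat \<longleftrightarrow>
     (\<exists>lam0 lam. (x, t, y, lam0, lam) \<in> sdp_feasible D \<theta> \<xi>hat)"
  unfolding aarc_feasible_iff_lmi[OF assms] sdp_feasible_def by auto

theorem proposition6:
  fixes D :: "('n::finite, 'm::finite, 's::finite, 'J::finite) two_stage"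
    and \<theta> :: real
    and \<xi>hat :: "'N::finite \<Rightarrow> real ^ 's"
  assumes "\<theta> > 0"
  shows "(\<forall>x t y. x \<in> stage1_set D \<longrightarrow>
            ((x, t, y) \<in> aarc_feasible D \<theta> \<xi>hat \<longleftrightarrow>
             (\<exists>lam0 lam. 0 \<le> lam0 \<and> (\<forall>i j. 0 \<le> lam i j) \<and>
                lmi_objective D \<theta> \<xi>hat x t y lam0 \<and> lmi_constraints D \<theta> \<xi>hat x y lam)))
       \<and> (INF (x, t, y) \<in> aarc_feasible D \<theta> \<xi>hat. ereal t)
           = (INF (x, t, y, lam0, lam) \<in> sdp_feasible D \<theta> \<xi>hat. ereal t)
       \<and> (\<forall>x t y. is_arg_min (\<lambda>(x, t, y). t) (\<lambda>z. z \<in> aarc_feasible D \<theta> \<xi>hat) (x, t, y) \<longleftrightarrow>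
            (\<exists>lam0 lam. is_arg_min (\<lambda>(x, t, y, lam0, lam). t) (\<lambda>z. z \<in> sdp_feasible D \<theta> \<xi>hat)
               (x, t, y, lam0, lam)))"
proof (intro conjI)
  note sdp = aarc_feasible_iff_sdp[OF assms]
  let ?A = "aarc_feasible D \<theta> \<xi>hat" and ?S = "sdp_feasible D \<theta> \<xi>hat"
  show "\<forall>x t y. x \<in> stage1_set D \<longrightarrow> ((x, t, y) \<in> ?A \<longleftrightarrow>
      (\<exists>lam0 lam. 0 \<le> lam0 \<and> (\<forall>i j. 0 \<le> lam i j) \<and>
         lmi_objective D \<theta> \<xi>hat x t y lam0 \<and> lmi_constraints D \<theta> \<xi>hat x y lam))"
    by (simp add: aarc_feasible_iff_lmi[OF assms])
  have "(\<lambda>(x, t, y). ereal t) ` ?A = (\<lambda>(x, t, y, lam0, lam). ereal t) ` ?S"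
    by (force simp: image_iff sdp Bex_def)
  then show "(INF (x, t, y) \<in> ?A. ereal t) = (INF (x, t, y, lam0, lam) \<in> ?S. ereal t)"
    by simp
  show "\<forall>x t y. is_arg_min (\<lambda>(x, t, y). t) (\<lambda>z. z \<in> ?A) (x, t, y) \<longleftrightarrow>
      (\<exists>lam0 lam. is_arg_min (\<lambda>(x, t, y, lam0, lam). t) (\<lambda>z. z \<in> ?S) (x, t, y, lam0, lam))"
    by (auto simp: is_arg_min_def sdp)
qed

end
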